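(* Let $q\in\mathbb{C}$ with $0<|q|<1$, and fix a square root $q^{1/2}$. Let $\alpha,\beta,\gamma\in\mathbb{C}^*$ satisfy $\alpha\beta^2=-1$ and $\beta\gamma=q$, and suppose $(\alpha\beta)^2\neq q^{2k}$ for all $k\in\mathbb{Z}$. Then for any $w\in\mathbb{C}^*$ with $\left|\frac{\gamma}{\alpha^2\beta}\right|<\left|\frac{\gamma w}{\alpha q^{1/2}}\right|<1$, $$ \frac{1}{2}\frac{(q;q^2)_\infty}{(q^2;q^2)_\infty} \left\{ \frac{\left(\frac{\gamma}{\alpha};q\right)_\infty}{(\alpha\beta;q)_\infty}\, {}_1\psi_1\!\left(\alpha\beta;\frac{\gamma}{\alpha};q,\frac{\gamma w}{\alpha q^{1/2}}\right) + \frac{(\beta^2\gamma;q)_\infty}{\left(\frac{1}{\beta};q\right)_\infty}\, {}_1\psi_1\!\left(\frac{1}{\beta};\beta^2\gamma;q,\frac{\gamma w}{\alpha q^{1/2}}\right) \right\} = \frac{\left(\frac{\gamma}{\alpha^2\beta};q^2\right)_\infty}{(\alpha^2\beta^2;q^2)_\infty}\, \frac{\left(\frac{\alpha q^{1/2}}{\gamma w}q,\ \frac{\alpha\beta w}{q^{1/2}}q;\,q^2\right)_\infty}{\left(\frac{\gamma w}{\alpha q^{1/2}},\ \frac{q^{1/2}}{\alpha\beta w};\,q^2\right)_\infty}. $$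
   Context: For $0<|p|<1$, the $p$-shifted factorial is $(a;p)_0=1$; $(a;p)_n=(1-a)(1-ap)\cdots(1-ap^{n-1})$ for $n\ge1$; $(a;p)_n=\left[(1-ap^{-1})(1-ap^{-2})\cdots(1-ap^{n})\right]^{-1}$ for $n\le-1$. Also $(a;p)_\infty=\lim_{n\to\infty}(a;p)_n=\prod_{k\ge0}(1-ap^k)$ and $(a_1,\dots,a_m;p)_\infty=(a_1;p)_\infty\cdots(a_m;p)_\infty$. The bilateral basic hypergeometric series is $${}_1\psi_1(a;b;q,z)=\sum_{n\in\mathbb{Z}}\frac{(a;q)_n}{(b;q)_n}z^n,$$ which converges for $|b/a|<|z|<1$. *)

theory Defs
  imports "HOL-Analysis.Analysis"
begin

definition qpoch :: "complex \<Rightarrow> complex \<Rightarrow> int \<Rightarrow> complex" where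
  "qpoch a p n =
     (if n \<ge> 0 then \<Prod>k<nat n. 1 - a * p ^ k
      else inverse (\<Prod>k=1..nat (-n). 1 - a * p powi (- int k)))"

definition qpoch_inf :: "complex \<Rightarrow> complex \<Rightarrow> complex" where
  "qpoch_inf a p = lim (\<lambda>n::nat. qpoch a p (int n))"

definition qpoch_infs :: "complex list \<Rightarrow> complex \<Rightarrow> complex" where
  "qpoch_infs as p = (\<Prod>a\<leftarrow>as. qpoch_inf a p)"

(* The sum over all integers is unconditional. For complex terms this is absolute convergence,
   which is the convergence that holds in the annulus |b/a| < |z| < 1; where the series is not
   summable, infsum returns the junk value 0. *)
definition psi11 :: "complex \<Rightarrow> complex \<Rightarrow> complex \<Rightarrow> complex \<Rightarrow> complex" where
  "psi11 a b q z = (\<Sum>\<^sub>\<infinity>n\<in>(UNIV::int set). qpoch a q n / qpoch b q n * z powi n)"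

end

theory Submission
  imports Defs
begin

text \<open>
  With \<open>a = \<alpha>\<beta>\<close> and \<open>z = \<gamma>w/(\<alpha>q\<^sup>1\<^sup>/\<^sup>2)\<close> the hypotheses force \<open>\<beta> = -1/a\<close>, \<open>\<alpha> = -a\<^sup>2\<close>,
  \<open>\<gamma> = -qa\<close>, so the two series are \<open>\<^sub>1\<psi>\<^sub>1(\<plusminus>a; \<plusminus>q/a; q, z)\<close>. Ramanujan's summation turns the bracket
  into a multiple of \<open>\<theta>(az)/\<theta>(a) + \<theta>(-az)/\<theta>(-a)\<close>, where \<open>\<theta>(x) = (x, q/x; q)\<^sub>\<infinity>\<close>. By the Jacobi
  triple product \<open>\<theta>(az)\<theta>(-a) + \<theta>(-az)\<theta>(a)\<close> is a double series over pairs \<open>(m, n)\<close> in which the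
  terms with \<open>m + n\<close> odd cancel; putting \<open>m = k + l\<close>, \<open>n = k - l\<close> separates it into a product
  of two theta functions in base \<open>q\<^sup>2\<close>.

  Ramanujan's summation is obtained from the \<open>q\<close>-Gauss sum, with numerator parameter \<open>aq\<^sup>-\<^sup>m\<close> and
  denominator parameter \<open>bq\<^sup>-\<^sup>m\<close>, by shifting the index by \<open>m\<close> and letting \<open>m\<close> tend to infinity;
  the triple product comes in the same way from Euler's series for \<open>(x; q)\<^sub>\<infinity>\<close>.
\<close>

section \<open>Summability and limits of series\<close>

lemma summable_norm_bounded_mult_power:
  fixes K :: "nat \<Rightarrow> complex"
  assumes "K \<longlonglongrightarrow> L" "norm z < 1"
  shows "summable (\<lambda>n. norm (K n * z ^ n))"
proof -
  have "Bseq K" using assms(1) by (meson convergentI convergent_imp_Bseq)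
  then obtain M where M: "\<And>n. norm (K n) \<le> M" by (auto simp: Bseq_def)
  show ?thesis
  proof (rule summable_comparison_test')
    show "summable (\<lambda>n. M * norm z ^ n)" using assms(2) by (intro summable_mult summable_geometric) auto
    show "norm (norm (K n * z ^ n)) \<le> M * norm z ^ n" if "n \<ge> 0" for n
      using M[of n] by (simp add: norm_mult norm_power mult_right_mono)
  qed
qed

lemma summable_norm_ratio_null:
  fixes u r :: "nat \<Rightarrow> complex"
  assumes u: "\<And>n. u (Suc n) = r n * u n" and r: "r \<longlonglongrightarrow> 0"
  shows "summable (\<lambda>n. norm (u n))"
proof -
  have "eventually (\<lambda>n. norm (r n) < 1 / 2) sequentially"
    using r by (intro order_tendstoD[OF tendsto_norm_zero]) auto
  then obtain N where N: "\<And>n. n \<ge> N \<Longrightarrow> norm (r n) < 1 / 2"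
    by (auto simp: eventually_sequentially)
  show ?thesis
  proof (rule summable_ratio_test)
    fix n assume n: "n \<ge> N"
    have "norm (u (Suc n)) = norm (r n) * norm (u n)" unfolding u norm_mult ..
    also have "\<dots> \<le> 1 / 2 * norm (u n)" using N[OF n] by (intro mult_right_mono) auto
    finally show "norm (norm (u (Suc n))) \<le> 1 / 2 * norm (norm (u n))" by simp
  qed simp
qed

lemma summable_norm_int:
  fixes f :: "int \<Rightarrow> complex"
  assumes "summable (\<lambda>n. norm (f (int n)))" "summable (\<lambda>n. norm (f (- int n)))"
  shows "(\<lambda>n. norm (f n)) summable_on UNIV"
proof -
  have 1: "(\<lambda>n. norm (f n)) summable_on range int"
    using assms(1) by (subst summable_on_reindex) (auto simp: o_def summable_on_UNIV_nonneg_real_iff)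
  have "(\<lambda>n. norm (f n)) summable_on range (\<lambda>n. - int n)"
    using assms(2) by (subst summable_on_reindex) (auto simp: o_def summable_on_UNIV_nonneg_real_iff inj_on_def)
  with 1 have "(\<lambda>n. norm (f n)) summable_on (range int \<union> range (\<lambda>n. - int n))"
    by (rule summable_on_union)
  moreover have "range int \<union> range (\<lambda>n. - int n) = UNIV"
  proof -
    have "x \<in> range int \<union> range (\<lambda>n. - int n)" for x
      by (cases x rule: int_cases2) auto
    then show ?thesis by blast
  qed
  ultimately show ?thesis by simp
qed

text \<open>Passes from one-sided sums to a bilateral one: \<open>S m\<close> runs over the window
  of indices from \<open>- m\<close> upwards, with \<open>c n\<close> weighted by
  \<open>K (n + m)\<close>. For fixed \<open>n\<close> the weight tends to 1, and \<open>K\<close>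
  is bounded, so dominated convergence applies.\<close>

lemma has_sum_int_shifted_limit:
  fixes c :: "int \<Rightarrow> complex" and K S :: "nat \<Rightarrow> complex"
  assumes c: "(\<lambda>n. norm (c n)) summable_on UNIV" and K: "K \<longlonglongrightarrow> 1"
    and S: "\<And>m. (\<lambda>j. c (int j - int m) * K j) sums S m" and L: "S \<longlonglongrightarrow> L"
  shows "(c has_sum L) UNIV"
proof -
  have "Bseq K" using K by (meson convergentI convergent_imp_Bseq)
  then obtain M where M: "M > 0" "\<And>n. norm (K n) \<le> M" by (auto simp: Bseq_def)
  \<comment> \<open>Extension by zero puts all windows on one index set, with a majorant
    \<open>M * norm (c n)\<close> independent of \<open>m\<close>.\<close>
  define f where "f m n = (if n + int m \<ge> 0 then c n * K (nat (n + int m)) else 0)" for m n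
  have fb: "norm (f m n) \<le> M * norm (c n)" for m n
    using M(2)[of "nat (n + int m)"] M(1)
    by (auto simp: f_def norm_mult mult.commute[of M] mult_left_mono)
  have Mc: "(\<lambda>n. M * norm (c n)) summable_on UNIV" using c by (rule summable_on_cmult_right)
  have fs: "(\<lambda>n. norm (f m n)) summable_on UNIV" for m
    using Infinite_Sum.abs_summable_on_comparison_test'[OF Mc fb] .
  have fsum: "infsum (f m) UNIV = S m" for m
  proof -
    have ran: "range (\<lambda>j. int j - int m) = {n. n + int m \<ge> 0}"
    proof (intro equalityI subsetI)
      fix x assume "x \<in> {n. n + int m \<ge> 0}"
      then have "x = int (nat (x + int m)) - int m" by simp
      then show "x \<in> range (\<lambda>j. int j - int m)" by blast
    qed auto
    have "infsum (f m) UNIV = infsum (f m) (range (\<lambda>j. int j - int m))"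
      unfolding ran by (rule infsum_cong_neutral) (auto simp: f_def)
    also have "\<dots> = infsum (\<lambda>j. c (int j - int m) * K j) UNIV"
      by (subst infsum_reindex) (auto simp: o_def f_def inj_on_def)
    also have "\<dots> = S m"
    proof -
      have "f m summable_on range (\<lambda>j. int j - int m)"
        by (rule summable_on_subset_banach[OF abs_summable_summable[OF fs]]) auto
      then have "(\<lambda>j. c (int j - int m) * K j) summable_on UNIV"
        by (subst (asm) summable_on_reindex) (auto simp: o_def f_def inj_on_def)
      then have "(\<lambda>j. c (int j - int m) * K j) sums infsum (\<lambda>j. c (int j - int m) * K j) UNIV"
        by (intro has_sum_imp_sums has_sum_infsum)
      with S show ?thesis using sums_unique2 by blast
    qed
    finally show ?thesis .
  qed
  have lim: "(\<lambda>m. f m n) \<longlonglongrightarrow> c n" for n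
  proof -
    have "filterlim (\<lambda>m. nat (n + int m)) at_top sequentially"
      unfolding filterlim_at_top
    proof
      fix Z show "eventually (\<lambda>m. Z \<le> nat (n + int m)) sequentially"
        using eventually_ge_at_top[of "nat (int Z - n)"] by eventually_elim linarith
    qed
    then have "(\<lambda>m. c n * K (nat (n + int m))) \<longlonglongrightarrow> c n * 1"
      by (intro tendsto_mult tendsto_const filterlim_compose[OF K])
    moreover have "eventually (\<lambda>m. c n * K (nat (n + int m)) = f m n) sequentially"
      using eventually_ge_at_top[of "nat (- n)"] by eventually_elim (auto simp: f_def)
    ultimately show ?thesis by (simp add: tendsto_cong[symmetric] Lim_transform_eventually)
  qed
  \<comment> \<open>\<open>infsum\<close> is rewritten as an integral over the counting measure, for
    which dominated convergence is available.\<close>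
  have i: "integrable (count_space UNIV) g" if "(\<lambda>n. norm (g n)) summable_on UNIV" for g :: "int \<Rightarrow> complex"
    using that abs_summable_equivalent[of g UNIV] by (simp add: Infinite_Set_Sum.abs_summable_on_def)
  have ii: "integral\<^sup>L (count_space UNIV) g = infsum g UNIV"
    if "(\<lambda>n. norm (g n)) summable_on UNIV" for g :: "int \<Rightarrow> complex"
    using that abs_summable_equivalent[of g UNIV] infsetsum_infsum[of g UNIV] by (simp add: infsetsum_def)
  have "(\<lambda>m. integral\<^sup>L (count_space UNIV) (f m)) \<longlonglongrightarrow> integral\<^sup>L (count_space UNIV) c"
  proof (rule integral_dominated_convergence[where w = "\<lambda>n. M * norm (c n)"])
    show "integrable (count_space UNIV) (\<lambda>n. M * norm (c n))"
      using i[OF c] by simp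
  qed (auto simp: lim fb)
  then have "S \<longlonglongrightarrow> infsum c UNIV" by (simp add: ii[OF fs] ii[OF c] fsum)
  then have "infsum c UNIV = L" using L LIMSEQ_unique by blast
  then show ?thesis using c by (metis abs_summable_summable has_sum_infsum)
qed

lemma infsum_eq_sums:
  fixes f :: "nat \<Rightarrow> complex"
  shows "f summable_on UNIV \<Longrightarrow> f sums S \<Longrightarrow> infsum f UNIV = S"
  using has_sum_imp_sums[OF has_sum_infsum] sums_unique2 by blast

lemma norm_summable_on_product:
  fixes f :: "'a \<Rightarrow> complex" and g :: "'b \<Rightarrow> complex"
  assumes "countable A" "countable B"
    and "(\<lambda>x. norm (f x)) summable_on A" "(\<lambda>x. norm (g x)) summable_on B"
  shows "(\<lambda>p. norm (case p of (x, y) \<Rightarrow> f x * g y)) summable_on A \<times> B"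
  using assms abs_summable_on_product[of A B f g] abs_summable_equivalent[of f A]
    abs_summable_equivalent[of g B] abs_summable_equivalent[of "\<lambda>(x, y). f x * g y" "A \<times> B"]
  by simp

lemma has_sum_product:
  fixes f :: "'a \<Rightarrow> complex" and g :: "'b \<Rightarrow> complex"
  assumes "countable A" "countable B"
    and "(\<lambda>x. norm (f x)) summable_on A" "(\<lambda>x. norm (g x)) summable_on B"
    and "(f has_sum S) A" "(g has_sum T) B"
  shows "((\<lambda>(x, y). f x * g y) has_sum S * T) (A \<times> B)"
proof (rule has_sum_SigmaI)
  show "((\<lambda>y. case (x, y) of (x, y) \<Rightarrow> f x * g y) has_sum f x * T) B" for x
    using has_sum_cmult_right[OF assms(6)] by simp
  show "((\<lambda>x. f x * T) has_sum S * T) A" using has_sum_cmult_left[OF assms(5)] .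
  show "(\<lambda>(x, y). f x * g y) summable_on A \<times> B"
    using norm_summable_on_product[OF assms(1-4)] by (rule abs_summable_summable)
qed

section \<open>Shifted factorials and unilateral series\<close>

locale q_base =
  fixes q :: complex
  assumes q_nz: "q \<noteq> 0" and q_less: "norm q < 1"
begin

abbreviation P :: "complex \<Rightarrow> complex" where "P x \<equiv> qpoch_inf x q"

definition fin :: "complex \<Rightarrow> nat \<Rightarrow> complex" where "fin x n = (\<Prod>k<n. 1 - x * q ^ k)"

lemma fin_0 [simp]: "fin x 0 = 1" and fin_Suc: "fin x (Suc n) = fin x n * (1 - x * q ^ n)"
  by (simp_all add: fin_def)

lemma fin_Suc': "fin x (Suc n) = (1 - x) * fin (x * q) n"
  by (simp only: fin_def prod.lessThan_Suc_shift) (simp add: mult_ac)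

lemma qpoch_nat: "qpoch x q (int n) = fin x n"
  by (simp add: qpoch_def fin_def)

lemma q_pow_tendsto: "(\<lambda>n. x * q ^ n) \<longlonglongrightarrow> 0"
  using tendsto_mult_right_zero[OF LIMSEQ_power_zero[OF q_less]] by simp

lemma abs_convergent_prod_qpoch: "abs_convergent_prod (\<lambda>k. 1 - x * q ^ k)"
proof -
  have "summable (\<lambda>k. norm (x * q ^ k))"
    using q_less by (auto simp: norm_mult norm_power intro!: summable_mult summable_geometric)
  then show ?thesis by (simp add: abs_convergent_prod_conv_summable)
qed

lemma convergent_prod_qpoch: "convergent_prod (\<lambda>k. 1 - x * q ^ k)"
  using abs_convergent_prod_qpoch by (rule abs_convergent_prod_imp_convergent_prod)

lemma P_eq_prodinf: "P x = prodinf (\<lambda>k. 1 - x * q ^ k)"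
  and fin_tendsto: "fin x \<longlonglongrightarrow> P x"
proof -
  have l: "fin x \<longlonglongrightarrow> prodinf (\<lambda>k. 1 - x * q ^ k)"
    using convergent_prod_LIMSEQ[OF convergent_prod_qpoch[of x]]
    unfolding fin_def by (simp add: LIMSEQ_lessThan_iff_atMost)
  then show e: "P x = prodinf (\<lambda>k. 1 - x * q ^ k)"
    unfolding qpoch_inf_def qpoch_nat by (rule limI)
  show "fin x \<longlonglongrightarrow> P x" unfolding e by (rule l)
qed

lemma P_nonzero: "(\<And>k. x * q ^ k \<noteq> 1) \<Longrightarrow> P x \<noteq> 0"
  unfolding P_eq_prodinf by (rule prodinf_nonzero[OF convergent_prod_qpoch]) (metis eq_iff_diff_eq_0)

lemma norm_mult_pow_less: "norm z < 1 \<Longrightarrow> norm (z * q ^ m) < 1"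
proof -
  assume z: "norm z < 1"
  have "norm (z * q ^ m) \<le> norm z * 1"
    unfolding norm_mult norm_power using q_less by (intro mult_left_mono power_le_one) auto
  with z show ?thesis by linarith
qed

lemma P_nonzero_less: "norm x < 1 \<Longrightarrow> P x \<noteq> 0"
  by (rule P_nonzero) (metis norm_mult_pow_less norm_one less_irrefl)

lemma P_rec: "P x = (1 - x) * P (x * q)"
proof -
  have "(\<lambda>n. fin x (Suc n)) \<longlonglongrightarrow> P x" using fin_tendsto LIMSEQ_Suc by blast
  moreover have "(\<lambda>n. fin x (Suc n)) \<longlonglongrightarrow> (1 - x) * P (x * q)"
    unfolding fin_Suc' by (intro tendsto_intros fin_tendsto)
  ultimately show ?thesis using LIMSEQ_unique by blast
qed

lemma P_eq_fin_mult: "P x = fin x n * P (x * q ^ n)"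
proof (induction n)
  case (Suc n)
  then show ?case using P_rec[of "x * q ^ n"] by (simp add: fin_Suc mult_ac)
qed auto

text \<open>By \<open>P_eq_fin_mult\<close>, \<open>P (y * q ^ n)\<close> is
  \<open>P y / fin y n\<close>, which tends to 1 if \<open>P y\<close> is nonzero. Starting at
  \<open>y = x * q ^ N\<close> with \<open>N\<close> large ensures this even where
  \<open>P x\<close> vanishes.\<close>

lemma P_shift_tendsto: "(\<lambda>n. P (x * q ^ n)) \<longlonglongrightarrow> 1"
proof -
  have "eventually (\<lambda>n. norm (x * q ^ n) < 1) sequentially"
    using q_pow_tendsto[of x] by (rule order_tendstoD[OF tendsto_norm_zero]) simp
  then obtain N where N: "norm (x * q ^ N) < 1" by (auto simp: eventually_sequentially)
  define y where "y = x * q ^ N"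
  have y: "P y \<noteq> 0" unfolding y_def using N by (rule P_nonzero_less)
  have "P (y * q ^ n) = P y / fin y n" for n
    using P_eq_fin_mult[of y n] y by (simp add: field_simps)
  moreover have "(\<lambda>n. P y / fin y n) \<longlonglongrightarrow> P y / P y"
    by (intro tendsto_intros fin_tendsto y)
  ultimately have "(\<lambda>n. P (y * q ^ n)) \<longlonglongrightarrow> 1" using y by simp
  then have "(\<lambda>n. P (x * q ^ (n + N))) \<longlonglongrightarrow> 1" by (simp add: y_def power_add mult_ac)
  then show ?thesis by (rule LIMSEQ_offset)
qed

lemma q_pow_neq_1: "n > 0 \<Longrightarrow> q ^ n \<noteq> 1"
  using q_less by (metis norm_one norm_power norm_ge_zero power_less_one_iff less_irrefl)

lemma fin_q_nonzero: "fin q n \<noteq> 0"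
  using q_pow_neq_1[of "Suc _"] by (auto simp: fin_def)

lemma P_q_nonzero: "P q \<noteq> 0" using q_less by (rule P_nonzero_less)

text \<open>Closes the iteration of a \<open>q\<close>-difference equation: the argument is driven
  to 0, where the power series is continuous.\<close>

lemma powser_shift_tendsto:
  fixes c :: "nat \<Rightarrow> complex"
  assumes "summable (\<lambda>n. c n * z ^ n)"
  shows "(\<lambda>m. \<Sum>n. c n * (z * q ^ m) ^ n) \<longlonglongrightarrow> c 0"
proof (cases "z = 0")
  case False
  have "isCont (\<lambda>x. \<Sum>n. c n * x ^ n) 0"
    by (rule isCont_powser[OF assms]) (use False in auto)
  from isCont_tendsto_compose[OF this q_pow_tendsto[of z]] show ?thesis by simp
qed simp

text \<open>The recurrence of the coefficients gives
  \<open>(1 - x) * g x = (1 - a * x) * g (x * q)\<close> for the sum \<open>g\<close>. Iterating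
  from \<open>z\<close> drives the argument to 0, where \<open>g\<close> has the value 1.\<close>

theorem q_binomial:
  assumes z: "norm z < 1"
  shows "(\<lambda>n. fin a n / fin q n * z ^ n) sums (P (a * z) / P z)"
proof -
  define c where "c n = fin a n / fin q n" for n
  have clim: "c \<longlonglongrightarrow> P a / P q"
    unfolding c_def by (intro tendsto_intros fin_tendsto P_q_nonzero)
  have sm: "summable (\<lambda>n. c n * x ^ n)" if "norm x < 1" for x
    using summable_norm_bounded_mult_power[OF clim that] by (rule summable_norm_cancel)
  define g where "g x = (\<Sum>n. c n * x ^ n)" for x
  have crec: "c (Suc n) * (1 - q ^ Suc n) = c n * (1 - a * q ^ n)" for n
    using q_pow_neq_1[of "Suc n"] by (simp add: c_def fin_Suc)
  have fe: "(1 - x) * g x = (1 - a * x) * g (x * q)" if x: "norm x < 1" for x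
  proof -
    have xq: "norm (x * q) < 1" using norm_mult_pow_less[OF x, of 1] by simp
    have s1: "(\<lambda>n. c n * x ^ n) sums g x" and s2: "(\<lambda>n. c n * (x * q) ^ n) sums g (x * q)"
      unfolding g_def using sm x xq by (auto intro: summable_sums)
    have d: "(\<lambda>n. c n * x ^ n - c n * (x * q) ^ n) sums (g x - g (x * q))"
      by (intro sums_diff s1 s2)
    have "(\<lambda>n. x * (c n * x ^ n) - a * x * (c n * (x * q) ^ n)) sums (x * g x - a * x * g (x * q))"
      by (intro sums_diff sums_mult s1 s2)
    moreover have "x * (c n * x ^ n) - a * x * (c n * (x * q) ^ n) =
       c (Suc n) * x ^ Suc n - c (Suc n) * (x * q) ^ Suc n" for n
    proof -
      have "c (Suc n) * x ^ Suc n - c (Suc n) * (x * q) ^ Suc n = (c (Suc n) * (1 - q ^ Suc n)) * x ^ Suc n"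
        by (simp add: power_mult_distrib algebra_simps)
      then show ?thesis unfolding crec by (simp add: power_mult_distrib algebra_simps)
    qed
    ultimately have "(\<lambda>n. c (Suc n) * x ^ Suc n - c (Suc n) * (x * q) ^ Suc n) sums (x * g x - a * x * g (x * q))"
      by simp
    then have "(\<lambda>n. c n * x ^ n - c n * (x * q) ^ n) sums (x * g x - a * x * g (x * q))"
      by (subst (asm) sums_Suc_iff) simp
    with d have "g x - g (x * q) = x * g x - a * x * g (x * q)" by (rule sums_unique2)
    then show ?thesis by (simp add: algebra_simps)
  qed
  have it: "g z = fin (a * z) n / fin z n * g (z * q ^ n)" for n
  proof (induction n)
    case (Suc n)
    have "1 - z * q ^ n \<noteq> 0" using norm_mult_pow_less[OF z, of n] by auto
    then have "g (z * q ^ n) = (1 - a * z * q ^ n) / (1 - z * q ^ n) * g (z * q ^ Suc n)"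
      using fe[OF norm_mult_pow_less[OF z, of n]] by (simp add: field_simps)
    then show ?case using Suc.IH by (simp add: fin_Suc mult_ac)
  qed simp
  have "(\<lambda>n. fin (a * z) n / fin z n * g (z * q ^ n)) \<longlonglongrightarrow> P (a * z) / P z * c 0"
    unfolding g_def by (intro tendsto_intros fin_tendsto P_nonzero_less z powser_shift_tendsto sm)
  then have "(\<lambda>n::nat. g z) \<longlonglongrightarrow> P (a * z) / P z" by (simp only: it[symmetric]) (simp add: c_def)
  then have "g z = P (a * z) / P z" by (simp add: LIMSEQ_const_iff)
  then show ?thesis using summable_sums[OF sm[OF z]] unfolding g_def c_def by simp
qed

text \<open>
  The \<open>q\<close>-Gauss sum with denominator parameter \<open>C = ABz\<close>. Writing \<open>(x; q)\<^sub>n\<close> as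
  \<open>P x / P (x * q ^ n)\<close> and cancelling \<open>P C\<close> makes the identity valid also where \<open>1 / (C; q)\<^sub>n\<close> has
  poles. As in Heine's transformation, the \<open>q\<close>-binomial theorem turns each side into an iterated
  sum of the same double series.
\<close>

theorem q_gauss:
  assumes B: "norm B < 1" and z: "norm z < 1" and A: "\<And>k. A * q ^ k \<noteq> 1"
  shows "(\<lambda>n. P (A * B * z * q ^ n) * P (q * q ^ n) / (P (A * q ^ n) * P (B * q ^ n)) * z ^ n)
           sums (P (A * z) * P (B * z) * P q / (P z * P A * P B))"
proof -
  define f where "f n = fin A n / fin q n * z ^ n" for n
  define g where "g m = fin (A * z) m / fin q m * B ^ m" for m
  \<comment> \<open>The kernel \<open>q ^ (n * m)\<close> replaces \<open>B\<close> by
    \<open>B * q ^ n\<close> in the sum over \<open>m\<close>, and \<open>z\<close> by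
    \<open>z * q ^ m\<close> in the sum over \<open>n\<close>, so the \<open>q\<close>-binomial
    theorem evaluates either inner sum.\<close>
  define t where "t n m = f n * g m * q ^ (n * m)" for n m
  have PA: "P (A * q ^ n) \<noteq> 0" for n
    using A[of "n + _"] by (intro P_nonzero) (simp add: power_add mult_ac)
  have "summable (\<lambda>n. norm (f n))"
    unfolding f_def
    by (rule summable_norm_bounded_mult_power[OF tendsto_divide[OF fin_tendsto fin_tendsto P_q_nonzero] z])
  moreover have "summable (\<lambda>n. norm (g n))"
    unfolding g_def
    by (rule summable_norm_bounded_mult_power[OF tendsto_divide[OF fin_tendsto fin_tendsto P_q_nonzero] B])
  ultimately have "(\<lambda>p. norm (case p of (n, m) \<Rightarrow> f n * g m)) summable_on UNIV \<times> UNIV"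
    by (intro norm_summable_on_product) (auto simp: summable_on_UNIV_nonneg_real_iff)
  then have "(\<lambda>p. norm (case p of (n, m) \<Rightarrow> t n m)) summable_on UNIV \<times> UNIV"
  proof (rule Infinite_Sum.abs_summable_on_comparison_test')
    fix p :: "nat \<times> nat"
    have "norm (q ^ k) \<le> 1" for k unfolding norm_power using q_less by (intro power_le_one) auto
    then show "norm (case p of (n, m) \<Rightarrow> t n m) \<le> norm (case p of (n, m) \<Rightarrow> f n * g m)"
      by (auto simp: t_def norm_mult mult_left_le split: prod.split)
  qed
  then have t: "(\<lambda>(n, m). t n m) summable_on UNIV \<times> UNIV" by (rule abs_summable_summable)
  have t': "(\<lambda>(m, n). t n m) summable_on UNIV \<times> UNIV"
    using t summable_on_swap[of "\<lambda>(n, m). t n m" UNIV UNIV] by simp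
  have inner1: "infsum (t n) UNIV = f n * (P (A * B * z * q ^ n) / P (B * q ^ n))" for n
  proof (rule infsum_eq_sums)
    show "t n summable_on UNIV" using summable_on_SigmaD1[OF t] by simp
    have "(\<lambda>m. f n * (fin (A * z) m / fin q m * (B * q ^ n) ^ m)) sums
            (f n * (P (A * z * (B * q ^ n)) / P (B * q ^ n)))"
      by (intro sums_mult q_binomial norm_mult_pow_less B)
    then show "t n sums (f n * (P (A * B * z * q ^ n) / P (B * q ^ n)))"
      by (simp add: t_def[abs_def] g_def power_mult_distrib power_mult mult_ac)
  qed
  have inner2: "infsum (\<lambda>n. t n m) UNIV = P (A * z) / P z * (fin z m / fin q m * B ^ m)" for m
  proof (rule infsum_eq_sums)
    show "(\<lambda>n. t n m) summable_on UNIV" using summable_on_SigmaD1[OF t'] by simp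
    have "(\<lambda>n. g m * (fin A n / fin q n * (z * q ^ m) ^ n)) sums
            (g m * (P (A * (z * q ^ m)) / P (z * q ^ m)))"
      by (intro sums_mult q_binomial norm_mult_pow_less z)
    moreover have "g m * (P (A * (z * q ^ m)) / P (z * q ^ m)) =
       P (A * z) / P z * (fin z m / fin q m * B ^ m)"
      using P_nonzero_less[OF norm_mult_pow_less[OF z, of m]] P_nonzero_less[OF z] fin_q_nonzero[of m]
        P_eq_fin_mult[of z m] P_eq_fin_mult[of "A * z" m]
      by (simp add: g_def field_simps)
    ultimately show "(\<lambda>n. t n m) sums (P (A * z) / P z * (fin z m / fin q m * B ^ m))"
      by (simp add: t_def f_def power_mult_distrib power_mult[symmetric] mult_ac)
  qed
  have "infsum (\<lambda>m. infsum (\<lambda>n. t n m) UNIV) UNIV = P (A * z) / P z * (P (z * B) / P B)"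
  proof (rule infsum_eq_sums)
    show "(\<lambda>m. infsum (\<lambda>n. t n m) UNIV) summable_on UNIV"
      using summable_on_Sigma_banach[OF t'] by simp
    show "(\<lambda>m. infsum (\<lambda>n. t n m) UNIV) sums (P (A * z) / P z * (P (z * B) / P B))"
      unfolding inner2 by (intro sums_mult q_binomial B)
  qed
  then have "infsum (\<lambda>n. infsum (t n) UNIV) UNIV = P (A * z) / P z * (P (z * B) / P B)"
    using infsum_swap_banach[OF t] by simp
  moreover have "(\<lambda>n. infsum (t n) UNIV) summable_on UNIV"
    using summable_on_Sigma_banach[OF t] by simp
  ultimately have "(\<lambda>n. infsum (t n) UNIV) sums (P (A * z) / P z * (P (z * B) / P B))"
    using has_sum_imp_sums has_sum_infsum by metis
  \<comment> \<open>The factor \<open>P q / P A\<close> turns \<open>fin A n / fin q n\<close> into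
    \<open>P (q * q ^ n) / P (A * q ^ n)\<close>.\<close>
  then have "(\<lambda>n. P q / P A * (f n * (P (A * B * z * q ^ n) / P (B * q ^ n)))) sums
     (P q / P A * (P (A * z) / P z * (P (z * B) / P B)))"
    unfolding inner1 by (rule sums_mult)
  moreover have "P q / P A * (f n * (P (A * B * z * q ^ n) / P (B * q ^ n))) =
    P (A * B * z * q ^ n) * P (q * q ^ n) / (P (A * q ^ n) * P (B * q ^ n)) * z ^ n" for n
    using PA[of n] PA[of 0] P_nonzero_less[OF norm_mult_pow_less[OF B, of n]] fin_q_nonzero[of n]
      P_eq_fin_mult[of A n] P_eq_fin_mult[of q n]
    by (simp add: f_def field_simps)
  ultimately show ?thesis by (simp add: mult_ac)
qed

text \<open>The method of \<open>q_binomial\<close> with the equation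
  \<open>g x = (1 - x) * g (x * q)\<close>; the ratios of successive terms tend to 0, so every
  \<open>x\<close> is allowed. The numerator \<open>(-x)^n q^(n(n-1)/2)\<close> is kept as a
  product, a form suited to induction.\<close>

lemma euler_powser: "(\<lambda>n. (\<Prod>k<n. - x * q ^ k) / fin q n) sums P x"
proof -
  define c where "c n = (\<Prod>k<n. - (q ^ k)) / fin q n" for n
  have crec: "c (Suc n) * (1 - q ^ Suc n) = - (q ^ n * c n)" for n
    using q_pow_neq_1[of "Suc n"] by (simp add: c_def fin_Suc)
  have sm: "summable (\<lambda>n. c n * x ^ n)" for x
  proof -
    have l: "(\<lambda>n. - (x * q ^ n) / (1 - q * q ^ n)) \<longlonglongrightarrow> - 0 / (1 - 0)"
      by (intro tendsto_intros q_pow_tendsto) auto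
    have "c (Suc n) * x ^ Suc n = - (x * q ^ n) / (1 - q * q ^ n) * (c n * x ^ n)" for n
    proof -
      have "c (Suc n) = - (q ^ n * c n) / (1 - q * q ^ n)"
        by (subst crec[of n, symmetric]) (use q_pow_neq_1[of "Suc n"] in auto)
      then show ?thesis by simp
    qed
    from summable_norm_cancel[OF summable_norm_ratio_null[where u = "\<lambda>n. c n * x ^ n", OF this]] l
    show ?thesis by simp
  qed
  define g where "g x = (\<Sum>n. c n * x ^ n)" for x
  have fe: "g x = (1 - x) * g (x * q)" for x
  proof -
    have s: "(\<lambda>n. c n * x ^ n) sums g x" for x
      unfolding g_def using sm by (rule summable_sums)
    have d: "(\<lambda>n. c n * x ^ n - c n * (x * q) ^ n) sums (g x - g (x * q))"
      by (intro sums_diff s)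
    have "(\<lambda>n. - x * (c n * (x * q) ^ n)) sums (- x * g (x * q))" by (intro sums_mult s)
    moreover have "- x * (c n * (x * q) ^ n) = c (Suc n) * x ^ Suc n - c (Suc n) * (x * q) ^ Suc n" for n
    proof -
      have "c (Suc n) * x ^ Suc n - c (Suc n) * (x * q) ^ Suc n = (c (Suc n) * (1 - q ^ Suc n)) * x ^ Suc n"
        by (simp add: power_mult_distrib algebra_simps)
      then show ?thesis unfolding crec by (simp add: power_mult_distrib algebra_simps)
    qed
    ultimately have "(\<lambda>n. c (Suc n) * x ^ Suc n - c (Suc n) * (x * q) ^ Suc n) sums (- x * g (x * q))"
      by simp
    then have "(\<lambda>n. c n * x ^ n - c n * (x * q) ^ n) sums (- x * g (x * q))"
      by (subst (asm) sums_Suc_iff) simp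
    with d have "g x - g (x * q) = - x * g (x * q)" by (rule sums_unique2)
    then show ?thesis by (simp add: algebra_simps)
  qed
  have it: "g x = fin x n * g (x * q ^ n)" for n
  proof (induction n)
    case (Suc n)
    then show ?case using fe[of "x * q ^ n"] by (simp add: fin_Suc mult_ac)
  qed simp
  have "(\<lambda>n. fin x n * g (x * q ^ n)) \<longlonglongrightarrow> P x * c 0"
    unfolding g_def by (intro tendsto_intros fin_tendsto powser_shift_tendsto sm)
  then have "(\<lambda>n::nat. g x) \<longlonglongrightarrow> P x" by (simp only: it[symmetric]) (simp add: c_def)
  then have "g x = P x" by (simp add: LIMSEQ_const_iff)
  moreover have "(\<Prod>k<n. - x * q ^ k) = (\<Prod>k<n. - (q ^ k)) * x ^ n" for n
    by (induction n) (auto simp: mult_ac)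
  ultimately show ?thesis using summable_sums[OF sm[of x]] unfolding g_def by (simp add: c_def)
qed

subsection \<open>Bilateral series\<close>

definition theta :: "complex \<Rightarrow> complex" where "theta x = P x * P (q / x)"

text \<open>The shift puts \<open>m\<close> factors in front, and
  \<open>1 - x * q powi (- j)\<close> equals \<open>- x * q powi (- j) * (1 - q ^ j / x)\<close>.
  The powers of \<open>q\<close> are collected in a product independent of \<open>x\<close>, which
  cancels in quotients; what remains has a visible limit in \<open>m\<close>.\<close>

lemma P_shift_neg:
  assumes "x \<noteq> 0"
  shows "P (x * q powi (- int m)) = (- x) ^ m * (\<Prod>k<m. inverse (q ^ Suc k)) * fin (q / x) m * P x"
proof (induction m)
  case (Suc m)
  have e: "x * q powi (- int (Suc m)) * q = x * q powi (- int m)"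
    using q_nz unfolding power_int_minus power_int_of_nat by (simp add: field_simps)
  have "P (x * q powi (- int (Suc m))) = (1 - x * q powi (- int (Suc m))) * P (x * q powi (- int m))"
    using P_rec[of "x * q powi (- int (Suc m))"] unfolding e .
  also have "1 - x * q powi (- int (Suc m)) = - x * inverse (q ^ Suc m) * (1 - q / x * q ^ m)"
    using q_nz assms unfolding power_int_minus power_int_of_nat by (simp add: field_simps)
  finally show ?case unfolding Suc.IH by (simp only: fin_Suc prod.lessThan_Suc power_Suc mult_ac)
qed auto

lemma prod_inverse_pow_nonzero: "(\<Prod>k<m. inverse (q ^ Suc k)) \<noteq> 0"
  using q_nz by auto

lemma P_nonzero_int: "(\<And>k::int. a * q powi k \<noteq> 1) \<Longrightarrow> P (a * q powi n) \<noteq> 0"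
  using q_nz by (intro P_nonzero) (metis power_int_add power_int_of_nat mult.assoc)

text \<open>Here \<open>b = aBz\<close>, so \<open>norm B < 1\<close> is the condition \<open>\<bar>b/a\<bar> < \<bar>z\<bar>\<close>.\<close>

theorem ramanujan_psi:
  assumes B: "norm B < 1" "B \<noteq> 0" and z: "norm z < 1" "z \<noteq> 0" and a: "a \<noteq> 0" "\<And>k::int. a * q powi k \<noteq> 1"
  shows "((\<lambda>n. P (a * B * z * q powi n) / P (a * q powi n) * z powi n) has_sum
           (P q * P (B * z) / (P z * P B) * (theta (a * z) / theta a))) UNIV"
proof -
  define c where "c n = P (a * B * z * q powi n) / P (a * q powi n) * z powi n" for n
  \<comment> \<open>The value of the \<open>q\<close>-Gauss sum at
    \<open>A = a * q powi (- int m)\<close>, divided by \<open>z ^ m\<close> because the index is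
    shifted by \<open>m\<close>.\<close>
  define S where "S m = P (a * z * q powi (- int m)) * P (B * z) * P q / (P z * P (a * q powi (- int m)) * P B) / z ^ m" for m
  have Pa: "P (a * q powi n) \<noteq> 0" for n using a(2) by (rule P_nonzero_int)
  have Pa0: "P a \<noteq> 0" using Pa[of 0] by simp
  have qa: "q / a * q ^ k \<noteq> 1" for k
    using a q_nz a(2)[of "- int (Suc k)"] unfolding power_int_minus power_int_of_nat by (auto simp: field_simps)
  have Pqa: "P (q / a) \<noteq> 0" using qa by (rule P_nonzero)
  have fqa: "fin (q / a) m \<noteq> 0" for m using qa by (auto simp: fin_def)
  show ?thesis unfolding c_def[symmetric]
  proof (rule has_sum_int_shifted_limit)
    show "(\<lambda>n. norm (c n)) summable_on UNIV"
    proof (rule summable_norm_int)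
      have "(\<lambda>n. P (a * B * z * q ^ n) / P (a * q ^ n)) \<longlonglongrightarrow> 1 / 1"
        by (intro tendsto_intros P_shift_tendsto) auto
      from summable_norm_bounded_mult_power[OF this z(1)]
      show "summable (\<lambda>n. norm (c (int n)))" by (simp add: c_def)
      \<comment> \<open>At negative indices \<open>P_shift_neg\<close> turns
        \<open>c (- int m)\<close> into a convergent factor times \<open>B ^ m\<close>, so
        \<open>norm B < 1\<close> gives summability there.\<close>
      have "(\<lambda>m. fin (q / (a * B * z)) m / fin (q / a) m * (P (a * B * z) / P a))
         \<longlonglongrightarrow> P (q / (a * B * z)) / P (q / a) * (P (a * B * z) / P a)"
        by (intro tendsto_intros fin_tendsto Pqa)
      from summable_norm_bounded_mult_power[OF this B(1)]
      have "summable (\<lambda>m. norm (fin (q / (a * B * z)) m / fin (q / a) m * (P (a * B * z) / P a) * B ^ m))" .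
      moreover have "c (- int m) = fin (q / (a * B * z)) m / fin (q / a) m * (P (a * B * z) / P a) * B ^ m" for m
        using a(1) B z fqa[of m] Pa0 prod_inverse_pow_nonzero[of m]
        unfolding c_def by (subst (1 2) P_shift_neg)
          (auto simp: power_int_minus field_simps power_mult_distrib
             power_minus[of a] power_minus[of "B * (a * z)"])
      ultimately show "summable (\<lambda>n. norm (c (- int n)))" by simp
    qed
    \<comment> \<open>The part of the \<open>q\<close>-Gauss summand that does not involve
      \<open>A\<close>; it depends on the one-sided index alone and serves as the weight
      \<open>K\<close>.\<close>
    have "(\<lambda>j. P (q * q ^ j) / P (B * q ^ j)) \<longlonglongrightarrow> 1 / 1"
      by (intro tendsto_intros P_shift_tendsto) auto
    then show "(\<lambda>j. P (q * q ^ j) / P (B * q ^ j)) \<longlonglongrightarrow> 1" by simp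
    show "(\<lambda>j. c (int j - int m) * (P (q * q ^ j) / P (B * q ^ j))) sums S m" for m
    proof -
      define A where "A = a * q powi (- int m)"
      have e: "y * q powi (int j - int m) = y * q powi (- int m) * q ^ j" for y j
        using q_nz by (simp add: power_int_diff power_int_minus field_simps)
      have "A * q ^ k \<noteq> 1" for k using a(2)[of "int k - int m"] unfolding e A_def .
      from sums_divide[OF q_gauss[OF B(1) z(1) this], of "z ^ m"]
      have "(\<lambda>n. P (A * B * z * q ^ n) * P (q * q ^ n) / (P (A * q ^ n) * P (B * q ^ n)) * z ^ n / z ^ m)
         sums S m"
        unfolding S_def by (simp add: A_def mult_ac)
      then show ?thesis using z(2)
        unfolding c_def e A_def by (simp add: power_int_diff mult_ac)
    qed
    \<comment> \<open>The powers of \<open>a\<close> and \<open>z\<close> from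
      \<open>P_shift_neg\<close> cancel against \<open>z ^ m\<close>, leaving a ratio of finite
      products that converges.\<close>
    have S: "S m = P q * P (B * z) / (P z * P B) * (P (a * z) / P a) * (fin (q / (a * z)) m / fin (q / a) m)" for m
      unfolding S_def using a(1) B z fqa[of m] Pa0 prod_inverse_pow_nonzero[of m]
        P_nonzero_less[OF B(1)] P_nonzero_less[OF z(1)]
      by (subst (1 2) P_shift_neg) (auto simp: field_simps power_mult_distrib power_minus[of a] power_minus[of "a * z"])
    have "(\<lambda>m. P q * P (B * z) / (P z * P B) * (P (a * z) / P a) * (fin (q / (a * z)) m / fin (q / a) m))
       \<longlonglongrightarrow> P q * P (B * z) / (P z * P B) * (P (a * z) / P a) * (P (q / (a * z)) / P (q / a))"
      by (intro tendsto_intros fin_tendsto Pqa)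
    then have "S \<longlonglongrightarrow> P q * P (B * z) / (P z * P B) * (P (a * z) / P a) * (P (q / (a * z)) / P (q / a))"
      unfolding S[symmetric] .
    then show "S \<longlonglongrightarrow> P q * P (B * z) / (P z * P B) * (theta (a * z) / theta a)"
      by (simp add: theta_def mult_ac)
  qed
qed

section \<open>Jacobi triple product\<close>

text \<open>The division by 2 is exact, since \<open>n * (n - 1)\<close> is even.\<close>

definition theta_term :: "complex \<Rightarrow> int \<Rightarrow> complex" where
  "theta_term x n = (- x) powi n * q powi (n * (n - 1) div 2)"

lemma theta_term_Suc: "x \<noteq> 0 \<Longrightarrow> theta_term x (n + 1) = - x * q powi n * theta_term x n"
proof -
  assume x: "x \<noteq> 0"
  have "(n + 1) * (n + 1 - 1) div 2 = n * (n - 1) div 2 + n"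
  proof -
    have "(n + 1) * (n + 1 - 1) = n * (n - 1) + n * 2" by (simp add: algebra_simps)
    then show ?thesis by simp
  qed
  then show ?thesis using x q_nz by (simp add: theta_term_def power_int_add)
qed

lemma summable_norm_ratio_pow:
  fixes u :: "nat \<Rightarrow> complex"
  assumes "\<And>n. u (Suc n) = y * q ^ n * u n"
  shows "summable (\<lambda>n. norm (u n))"
  using assms q_pow_tendsto by (rule summable_norm_ratio_null)

lemma theta_term_neg_Suc: "x \<noteq> 0 \<Longrightarrow> theta_term x (- int m) = - x * inverse (q ^ Suc m) * theta_term x (- int (Suc m))"
  using theta_term_Suc[of x "- int (Suc m)"] unfolding power_int_minus power_int_of_nat by simp

lemma theta_term_norm_summable:
  assumes "x \<noteq> 0"
  shows "(\<lambda>n. norm (theta_term x n)) summable_on UNIV"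
proof (rule summable_norm_int)
  show "summable (\<lambda>n. norm (theta_term x (int n)))"
    by (rule summable_norm_ratio_pow[of _ "- x"]) (use theta_term_Suc[OF assms, of "int _"] in \<open>simp add: add.commute\<close>)
  show "summable (\<lambda>n. norm (theta_term x (- int n)))"
    by (rule summable_norm_ratio_pow[of _ "- q / x"])
      (subst (2) theta_term_neg_Suc, use assms q_nz in \<open>simp_all add: field_simps\<close>)
qed

text \<open>Euler's series at \<open>x * q powi (- int m)\<close>, normalised so that its term of
  index \<open>j\<close> becomes \<open>theta_term x (j - m)\<close> with weight
  \<open>P (q * q ^ j)\<close>; the window grows to all integers with \<open>m\<close>.\<close>

theorem jacobi_triple:
  assumes x: "x \<noteq> 0"
  shows "(theta_term x has_sum (P q * theta x)) UNIV"
proof (rule has_sum_int_shifted_limit)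
  show "(\<lambda>n. norm (theta_term x n)) summable_on UNIV" using x by (rule theta_term_norm_summable)
  show "(\<lambda>j. P (q * q ^ j)) \<longlonglongrightarrow> 1" by (rule P_shift_tendsto)
  have "(\<lambda>m. P q * (P x * fin (q / x) m)) \<longlonglongrightarrow> P q * (P x * P (q / x))"
    by (intro tendsto_intros fin_tendsto)
  then show "(\<lambda>m. P q * (P x * fin (q / x) m)) \<longlonglongrightarrow> P q * theta x" by (simp add: theta_def)
  fix m
  \<comment> \<open>\<open>R\<close> is the reciprocal of \<open>theta_term x (- int m)\<close>, as
    \<open>base\<close> shows, so dividing by it aligns the start of Euler's series with the index
    \<open>- m\<close>.\<close>
  define R where "R = (- x) ^ m * (\<Prod>k<m. inverse (q ^ Suc k))"
  have R: "R \<noteq> 0" using x q_nz by (auto simp: R_def)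
  have base: "theta_term x (- int m) * ((- x) ^ m * (\<Prod>k<m. inverse (q ^ Suc k))) = 1" for m
  proof (induction m)
    case (Suc m)
    have "theta_term x (- int (Suc m)) * ((- x) ^ Suc m * (\<Prod>k<Suc m. inverse (q ^ Suc k)))
      = (- x * inverse (q ^ Suc m) * theta_term x (- int (Suc m))) * ((- x) ^ m * (\<Prod>k<m. inverse (q ^ Suc k)))"
      by (simp only: prod.lessThan_Suc power_Suc mult_ac)
    also have "\<dots> = 1" unfolding theta_term_neg_Suc[OF x, symmetric] by (rule Suc.IH)
    finally show ?case .
  qed (simp add: theta_term_def)
  have e: "(\<Prod>k<j. - (x * q powi (- int m)) * q ^ k) = theta_term x (int j - int m) * R" for j
  proof (induction j)
    case 0
    then show ?case using base[of m] by (simp add: R_def)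
  next
    case (Suc j)
    have "theta_term x (int (Suc j) - int m) = - x * q powi (int j - int m) * theta_term x (int j - int m)"
      using theta_term_Suc[OF x, of "int j - int m"] by (simp add: algebra_simps)
    moreover have "q powi (int j - int m) = q powi (- int m) * q ^ j"
      using q_nz by (simp add: power_int_diff power_int_minus field_simps)
    ultimately show ?case using Suc.IH by (simp add: mult_ac)
  qed
  have "(\<lambda>j. P q / R * ((\<Prod>k<j. - (x * q powi (- int m)) * q ^ k) / fin q j)) sums (P q / R * P (x * q powi (- int m)))"
    by (intro sums_mult euler_powser)
  moreover have "P q / R * P (x * q powi (- int m)) = P q * (P x * fin (q / x) m)"
    using R unfolding P_shift_neg[OF x] R_def[symmetric] by simp
  moreover have "P q / R * ((\<Prod>k<j. - (x * q powi (- int m)) * q ^ k) / fin q j) =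
     theta_term x (int j - int m) * P (q * q ^ j)" for j
    unfolding e using R P_eq_fin_mult[of q j] fin_q_nonzero[of j] by (simp add: field_simps)
  ultimately show "(\<lambda>j. theta_term x (int j - int m) * P (q * q ^ j)) sums (P q * (P x * fin (q / x) m))"
    by simp
qed

end

section \<open>Theta functions in base \<open>q\<^sup>2\<close>\<close>

lemma q_base_power2: "q_base q \<Longrightarrow> q_base (q ^ 2)"
  unfolding q_base_def by (simp add: norm_power power_less_one_iff)

context q_base
begin

interpretation Q2: q_base "q ^ 2"
  by (rule q_base_power2) (rule q_base_axioms)

text \<open>Separates the factors with even and with odd exponent of \<open>q\<close>.\<close>

lemma P_dissect: "P x = Q2.P x * Q2.P (x * q)"
proof -
  have "fin x (2 * n) = Q2.fin x n * Q2.fin (x * q) n" for n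
    by (induction n) (simp_all add: fin_Suc Q2.fin_Suc power_mult[symmetric] mult_ac)
  then have "(\<lambda>n. fin x (2 * n)) \<longlonglongrightarrow> Q2.P x * Q2.P (x * q)"
    by (simp add: tendsto_mult Q2.fin_tendsto)
  moreover have "(\<lambda>n. fin x (2 * n)) \<longlonglongrightarrow> P x"
    using fin_tendsto LIMSEQ_subseq_LIMSEQ[of "fin x" _ "\<lambda>n. 2 * n"] by (simp add: strict_mono_def o_def)
  ultimately show ?thesis using LIMSEQ_unique by blast
qed

text \<open>Holds factor by factor, as a difference of squares; it brings
  \<open>theta a * theta (- a)\<close> into base \<open>q ^ 2\<close>.\<close>

lemma P_mult_P_minus: "P x * P (- x) = Q2.P (x ^ 2)"
proof -
  have "fin x n * fin (- x) n = Q2.fin (x ^ 2) n" for n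
  proof (induction n)
    case (Suc n)
    have "(1 - x * q ^ n) * (1 - - x * q ^ n) = 1 - x ^ 2 * (q ^ 2) ^ n"
      by (simp add: power2_eq_square power_mult_distrib algebra_simps)
    then show ?case using Suc.IH by (simp only: fin_Suc Q2.fin_Suc) (metis mult.assoc mult.left_commute)
  qed simp
  then have "(\<lambda>n. Q2.fin (x ^ 2) n) \<longlonglongrightarrow> P x * P (- x)"
    using tendsto_mult[OF fin_tendsto fin_tendsto, of x "- x"] by simp
  then show ?thesis using Q2.fin_tendsto LIMSEQ_unique by blast
qed

text \<open>With \<open>T n = n(n-1)/2\<close> one has
  \<open>T (k + l) + T (k - l) = 2 * T k + 2 * T l + l\<close>, and the extra \<open>l\<close> is
  absorbed into the argument \<open>q * z\<close>. As \<open>k + l\<close> and \<open>k - l\<close>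
  have the same parity, both products carry the same sign and coincide, whence the factor 2.\<close>

lemma theta_term_pair:
  assumes "a \<noteq> 0" "z \<noteq> 0"
  shows "theta_term (a * z) (k + l) * theta_term (- a) (k - l) + theta_term (- (a * z)) (k + l) * theta_term a (k - l)
     = 2 * (Q2.theta_term (a ^ 2 * z) k * Q2.theta_term (q * z) l)"
proof -
  define T :: "int \<Rightarrow> int" where "T n = n * (n - 1) div 2" for n
  have T2: "2 * T n = n * (n - 1)" for n unfolding T_def by simp
  have T: "T (k + l) + T (k - l) = 2 * T k + 2 * T l + l"
  proof -
    have "2 * (T (k + l) + T (k - l)) = 2 * (2 * T k + 2 * T l + l)"
      by (simp only: distrib_left mult.assoc T2) (simp add: algebra_simps)
    then show ?thesis by simp
  qed
  have sg: "(- 1 :: complex) powi (k - l) = (- 1) powi (k + l)"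
    by (simp add: power_int_minus_left)
  have tt: "theta_term x n = (- 1) powi n * x powi n * q powi T n" for x n
    unfolding theta_term_def T_def power_int_mult_distrib[symmetric] by simp
  have tt2: "Q2.theta_term x n = (- 1) powi n * x powi n * q powi (2 * T n)" for x n
    unfolding Q2.theta_term_def T_def power_int_mult_distrib[symmetric] power_int_mult by simp
  have neg: "(- x) powi n = (- 1) powi n * x powi n" for x :: complex and n
    unfolding power_int_mult_distrib[symmetric] by simp
  have one: "(- 1 :: complex) powi n * (- 1) powi n = 1" for n
    unfolding power_int_mult_distrib[symmetric] by simp
  have "q powi T (k + l) * q powi T (k - l) = q powi (2 * T k) * q powi (2 * T l) * q powi l"
    using q_nz by (simp only: power_int_add[symmetric] T simp_thms)
  moreover have "a powi (k + l) * a powi (k - l) = (a ^ 2) powi k"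
    using assms(1) by (simp add: power_int_add[symmetric] power_int_mult[symmetric] power_int_power)
  moreover have "(- 1 :: complex) powi (k + l) = (- 1) powi k * (- 1) powi l"
    by (rule power_int_add) simp
  moreover have "z powi (k + l) = z powi k * z powi l" using assms by (simp add: power_int_add)
  moreover have "theta_term (a * z) (k + l) * theta_term (- a) (k - l)
      + theta_term (- (a * z)) (k + l) * theta_term a (k - l)
    = 2 * ((- 1) powi (k + l) * (- 1) powi (k + l)) * (- 1) powi (k + l) * (a powi (k + l) * a powi (k - l))
       * z powi (k + l) * (q powi T (k + l) * q powi T (k - l))"
    unfolding tt neg[of a] neg[of "a * z"] sg power_int_mult_distrib by (simp only: mult_2[symmetric] mult_ac)
  ultimately show ?thesis
    unfolding one by (simp only: tt2 power_int_mult_distrib mult_1_left mult_1_right mult_ac)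
qed

text \<open>The two products differ only in their signs \<open>(-1)^m\<close> and
  \<open>(-1)^n\<close>, which are opposite here.\<close>

lemma theta_term_pair_odd:
  assumes "odd (m + n)"
  shows "theta_term (a * z) m * theta_term (- a) n + theta_term (- (a * z)) m * theta_term a n = 0"
  using assms by (auto simp: theta_term_def power_int_minus_left)

lemma theta_addition:
  assumes a: "a \<noteq> 0" and z: "z \<noteq> 0"
  shows "P q ^ 2 * (theta (a * z) * theta (- a) + theta (- (a * z)) * theta a)
    = 2 * Q2.P (q ^ 2) ^ 2 * (Q2.theta (a ^ 2 * z) * Q2.theta (q * z))"
proof -
  define s where "s = (\<lambda>(m, n). theta_term (a * z) m * theta_term (- a) n + theta_term (- (a * z)) m * theta_term a n)"
  define u where "u = (\<lambda>(k, l). Q2.theta_term (a ^ 2 * z) k * Q2.theta_term (q * z) l)"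
  \<comment> \<open>Injective, and the pairs outside its range are those with odd sum, where
    \<open>s\<close> vanishes.\<close>
  define h :: "int \<times> int \<Rightarrow> int \<times> int" where "h = (\<lambda>(k, l). (k + l, k - l))"
  have prod: "((\<lambda>(m, n). theta_term x m * theta_term y n) has_sum (P q * theta x) * (P q * theta y)) UNIV"
    if "x \<noteq> 0" "y \<noteq> 0" for x y
    using has_sum_product[OF _ _ theta_term_norm_summable theta_term_norm_summable jacobi_triple jacobi_triple, of x y] that
    by simp
  have s: "(s has_sum ((P q * theta (a * z)) * (P q * theta (- a)) + (P q * theta (- (a * z))) * (P q * theta a))) UNIV"
    using has_sum_add[OF prod[of "a * z" "- a"] prod[of "- (a * z)" a]] a z
    by (simp add: s_def case_prod_unfold)
  have "(u has_sum (Q2.P (q ^ 2) * Q2.theta (a ^ 2 * z)) * (Q2.P (q ^ 2) * Q2.theta (q * z))) UNIV"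
    unfolding u_def
    using has_sum_product[OF _ _ Q2.theta_term_norm_summable Q2.theta_term_norm_summable
        Q2.jacobi_triple Q2.jacobi_triple, of "a ^ 2 * z" "q * z"] a z q_nz
    by simp
  from has_sum_cmult_right[OF this, of 2]
  have "((\<lambda>p. s (h p)) has_sum 2 * ((Q2.P (q ^ 2) * Q2.theta (a ^ 2 * z)) * (Q2.P (q ^ 2) * Q2.theta (q * z)))) UNIV"
    using theta_term_pair[OF a z] by (simp add: s_def u_def h_def case_prod_unfold)
  moreover have "inj h" by (auto simp: inj_on_def h_def)
  ultimately have 1: "(s has_sum 2 * ((Q2.P (q ^ 2) * Q2.theta (a ^ 2 * z)) * (Q2.P (q ^ 2) * Q2.theta (q * z)))) (range h)"
    by (subst has_sum_reindex) (auto simp: o_def)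
  have "(s has_sum 2 * ((Q2.P (q ^ 2) * Q2.theta (a ^ 2 * z)) * (Q2.P (q ^ 2) * Q2.theta (q * z)))) UNIV"
  proof (subst has_sum_cong_neutral)
    show "s p = 0" if "p \<in> UNIV - range h" for p
    proof (cases p)
      case (Pair m n)
      have "odd (m + n)"
      proof
        assume e: "even (m + n)"
        have "p = h ((m + n) div 2, (m - n) div 2)"
          unfolding Pair h_def prod.case prod.inject using e by (intro conjI; presburger)
        with that show False by blast
      qed
      then show ?thesis using theta_term_pair_odd by (simp add: s_def Pair)
    qed
    show "(s has_sum 2 * ((Q2.P (q ^ 2) * Q2.theta (a ^ 2 * z)) * (Q2.P (q ^ 2) * Q2.theta (q * z)))) (range h)"
      by (rule 1)
  qed auto
  with s have "(P q * theta (a * z)) * (P q * theta (- a)) + (P q * theta (- (a * z))) * (P q * theta a)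
    = 2 * ((Q2.P (q ^ 2) * Q2.theta (a ^ 2 * z)) * (Q2.P (q ^ 2) * Q2.theta (q * z)))"
    using has_sum_unique by blast
  then show ?thesis by (simp add: power2_eq_square algebra_simps)
qed

section \<open>From theta functions back to \<open>psi11\<close>\<close>

text \<open>One formula for both signs of \<open>n\<close>: for negative \<open>n\<close> the
  inverted product consists of the factors that the shift puts in front of \<open>P a\<close>. The
  hypothesis keeps both values of \<open>P\<close> nonzero.\<close>

lemma qpoch_eq_P:
  assumes a: "\<And>k::int. a * q powi k \<noteq> 1"
  shows "qpoch a q n = P a / P (a * q powi n)"
proof (cases "n \<ge> 0")
  case True
  then obtain m where n: "n = int m" using nonneg_int_cases by blast
  have "P (a * q powi n) \<noteq> 0" using P_nonzero_int[OF a] .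
  then show ?thesis unfolding n qpoch_nat using P_eq_fin_mult[of a m] by simp
next
  case False
  then obtain m where n: "n = - int m" by (metis int_cases2 of_nat_0_le_iff)
  have "P (a * q powi (- int m)) = (\<Prod>k=1..m. 1 - a * q powi (- int k)) * P a" for m
  proof (induction m)
    case (Suc m)
    have e: "a * q powi (- int (Suc m)) * q = a * q powi (- int m)"
      using q_nz unfolding power_int_minus power_int_of_nat by (simp add: field_simps)
    show ?case using P_rec[of "a * q powi (- int (Suc m))"] unfolding e Suc.IH
      by (simp del: of_nat_Suc add: mult_ac)
  qed simp
  moreover have "P a \<noteq> 0" using P_nonzero_int[OF a, of 0] by simp
  moreover have "qpoch a q n = inverse (\<Prod>k=1..m. 1 - a * q powi (- int k))"
    using False by (simp add: qpoch_def n)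
  ultimately show ?thesis by (simp add: n divide_simps)
qed

text \<open>The prefactor \<open>P (a * B * z) / P a\<close> turns each quotient of
  \<open>qpoch\<close> values into the quotient of \<open>P\<close> values summed in
  \<open>ramanujan_psi\<close>.\<close>

lemma psi11_theta:
  assumes B: "norm B < 1" "B \<noteq> 0" and z: "norm z < 1" "z \<noteq> 0" and a: "a \<noteq> 0" "\<And>k::int. a * q powi k \<noteq> 1"
    and b: "\<And>k::int. a * B * z * q powi k \<noteq> 1"
  shows "P (a * B * z) / P a * psi11 a (a * B * z) q z = P q * P (B * z) / (P z * P B) * (theta (a * z) / theta a)"
proof -
  have nz: "P a \<noteq> 0" "P (a * B * z) \<noteq> 0"
    using P_nonzero_int[OF a(2), of 0] P_nonzero_int[OF b, of 0] by simp_all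
  from has_sum_cmult_right[OF ramanujan_psi[OF assms(1-6)], of "P a / P (a * B * z)"]
  have "((\<lambda>n. qpoch a q n / qpoch (a * B * z) q n * z powi n) has_sum
     P a / P (a * B * z) * (P q * P (B * z) / (P z * P B) * (theta (a * z) / theta a))) UNIV"
    unfolding qpoch_eq_P[OF a(2)] qpoch_eq_P[OF b] by (simp add: divide_simps mult_ac)
  then show ?thesis using nz by (simp add: psi11_def infsumI)
qed

text \<open>The final identity in the parameters \<open>a\<close> and \<open>z\<close> that remain
  once the relations between \<alpha>, \<beta> and \<gamma> are solved.\<close>

lemma psi11_pair:
  assumes z: "norm z < 1" "z \<noteq> 0" and B: "norm (q / (a ^ 2 * z)) < 1" and a: "a \<noteq> 0"
    and ai: "\<And>k::int. a ^ 2 \<noteq> q powi (2 * k)"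
  shows "1 / 2 * (Q2.P q / Q2.P (q ^ 2)) * (P (q / a) / P a * psi11 a (q / a) q z
       + P (- (q / a)) / P (- a) * psi11 (- a) (- (q / a)) q z)
    = Q2.P (q / a ^ 2) / Q2.P (a ^ 2)
       * ((Q2.P (q / z) * Q2.P (a ^ 2 * z)) / (Q2.P z * Q2.P (q / (a ^ 2 * z))))"
proof -
  \<comment> \<open>Chosen so that \<open>a * B * z = q / a\<close>. It is even in \<open>a\<close>,
    so both series get the same prefactor \<open>P q * P (B * z) / (P z * P B)\<close>.\<close>
  define B where "B = q / (a ^ 2 * z)"
  have e: "a * B * z = q / a" "- a * B * z = - (q / a)" "B * z = q / a ^ 2"
    using a z by (simp_all add: B_def power2_eq_square)
  \<comment> \<open>Working with \<open>c ^ 2 = a ^ 2\<close> covers \<open>a\<close> and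
    \<open>- a\<close> at once; \<open>c * q powi k = 1\<close> would make \<open>a ^ 2\<close> an
    even power of \<open>q\<close>.\<close>
  have sq: "(c * q powi k) ^ 2 \<noteq> 1" if "c ^ 2 = a ^ 2" for k :: int and c
  proof
    assume "(c * q powi k) ^ 2 = 1"
    then have "a ^ 2 * q powi (2 * k) = 1"
      by (simp add: power_mult_distrib that power_int_power' mult.commute)
    then have "a ^ 2 = q powi (2 * (- k))"
      using q_nz by (simp add: power_int_minus eq_divide_eq field_simps)
    with ai show False by blast
  qed
  have na: "c * q powi k \<noteq> 1" if "c ^ 2 = a ^ 2" for k :: int and c
    using sq[OF that, of k] by auto
  have nb: "q / c * q powi k \<noteq> 1" if c: "c ^ 2 = a ^ 2" for k :: int and c
  proof
    assume "q / c * q powi k = 1"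
    moreover have "c \<noteq> 0" using c a by auto
    ultimately have "c = q powi (k + 1)" using q_nz by (simp add: power_int_add field_simps)
    then have "c * q powi (- (k + 1)) = 1" using q_nz by (simp only: power_int_minus) simp
    with na[OF c] show False by blast
  qed
  have B': "norm B < 1" "B \<noteq> 0" using B a z q_nz by (auto simp: B_def)
  have psi1: "P (q / a) / P a * psi11 a (q / a) q z = P q * P (q / a ^ 2) / (P z * P B) * (theta (a * z) / theta a)"
    using psi11_theta[OF B' z a na, unfolded e] nb[of a] by simp
  have psi2: "P (- (q / a)) / P (- a) * psi11 (- a) (- (q / a)) q z
     = P q * P (q / a ^ 2) / (P z * P B) * (theta (- (a * z)) / theta (- a))"
    using psi11_theta[OF B' z, of "- a", unfolded e] a na[of "- a"] nb[of "- a"] by simp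
  have th: "theta a * theta (- a) = Q2.theta (a ^ 2)"
    using P_mult_P_minus[of a] P_mult_P_minus[of "q / a"]
    by (simp add: theta_def Q2.theta_def power_divide mult_ac)
  have pow: "a * q ^ k \<noteq> 1" "- a * q ^ k \<noteq> 1" "q / a * q ^ k \<noteq> 1" "q / (- a) * q ^ k \<noteq> 1" for k
    using na[of a "int k"] na[of "- a" "int k"] nb[of a "int k"] nb[of "- a" "int k"] by simp_all
  have thnz: "theta a \<noteq> 0" "theta (- a) \<noteq> 0"
    unfolding theta_def using P_nonzero[OF pow(1)] P_nonzero[OF pow(2)] P_nonzero[OF pow(3)] P_nonzero[OF pow(4)]
    by simp_all
  have q2: "norm (q ^ 2) < 1" using Q2.q_less .
  have nz: "P q \<noteq> 0" "P z \<noteq> 0" "P B \<noteq> 0" "Q2.P (q ^ 2) \<noteq> 0"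
    using P_nonzero_less[OF q_less] P_nonzero_less[OF z(1)] P_nonzero_less[OF B'(1)] Q2.P_nonzero_less[OF q2] .
  \<comment> \<open>The numerator of the bracket over the common denominator
    \<open>theta a * theta (- a)\<close>, in the shape evaluated by
    \<open>theta_addition\<close>.\<close>
  define X where "X = theta (a * z) * theta (- a) + theta (- (a * z)) * theta a"
  have X: "X = 2 * Q2.P (q ^ 2) ^ 2 * (Q2.theta (a ^ 2 * z) * Q2.theta (q * z)) / P q ^ 2"
    using theta_addition[OF a z(2)] nz unfolding X_def by (simp add: field_simps)
  have "theta (a * z) / theta a + theta (- (a * z)) / theta (- a) = X / Q2.theta (a ^ 2)"
    using thnz unfolding X_def th[symmetric] by (simp add: field_simps)
  then have "1 / 2 * (Q2.P q / Q2.P (q ^ 2)) * (P (q / a) / P a * psi11 a (q / a) q z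
       + P (- (q / a)) / P (- a) * psi11 (- a) (- (q / a)) q z)
    = 1 / 2 * (Q2.P q / Q2.P (q ^ 2)) * (P q * P (q / a ^ 2) / (P z * P B) * (X / Q2.theta (a ^ 2)))"
    unfolding psi1 psi2 distrib_left[symmetric] by simp
  also have "\<dots> = Q2.P q * Q2.P (q ^ 2) / P q * P (q / a ^ 2) / (P z * P B)
      * (Q2.theta (a ^ 2 * z) * Q2.theta (q * z)) / Q2.theta (a ^ 2)"
    unfolding X using nz by (simp add: field_simps power2_eq_square)
  also have "Q2.P q * Q2.P (q ^ 2) / P q = 1"
    using P_dissect[of q] nz by (simp add: power2_eq_square)
  also have "1 * P (q / a ^ 2) / (P z * P B) * (Q2.theta (a ^ 2 * z) * Q2.theta (q * z)) / Q2.theta (a ^ 2)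
    = Q2.P (q / a ^ 2) / Q2.P (a ^ 2)
       * ((Q2.P (q / z) * Q2.P (a ^ 2 * z)) / (Q2.P z * Q2.P B))"
  proof -
    \<comment> \<open>After dissection, \<open>Q2.P (q ^ 2 / a ^ 2)\<close>,
      \<open>Q2.P (q * z)\<close> and \<open>Q2.P (q ^ 2 / (a ^ 2 * z))\<close> cancel against
      factors of the theta functions in \<open>t\<close>.\<close>
    have d: "P (q / a ^ 2) = Q2.P (q / a ^ 2) * Q2.P (q ^ 2 / a ^ 2)" "P z = Q2.P z * Q2.P (q * z)"
      "P B = Q2.P B * Q2.P (q ^ 2 / (a ^ 2 * z))"
      using P_dissect[of "q / a ^ 2"] P_dissect[of z] P_dissect[of B]
      by (simp_all add: B_def power2_eq_square mult_ac)
    have t: "Q2.theta (a ^ 2 * z) = Q2.P (a ^ 2 * z) * Q2.P (q ^ 2 / (a ^ 2 * z))"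
      "Q2.theta (q * z) = Q2.P (q * z) * Q2.P (q / z)" "Q2.theta (a ^ 2) = Q2.P (a ^ 2) * Q2.P (q ^ 2 / a ^ 2)"
      unfolding Q2.theta_def using q_nz by (simp_all add: power2_eq_square)
    have "Q2.theta (a ^ 2) \<noteq> 0" using thnz th by (metis mult_eq_0_iff)
    with nz(2,3) show ?thesis unfolding d t by (simp add: mult_ac)
  qed
  finally show ?thesis unfolding B_def .
qed

end

theorem theorem1:
  fixes q s \<alpha> \<beta> \<gamma> w :: complex
  assumes "0 < norm q" and "norm q < 1"
    and "s ^ 2 = q"
    and "\<alpha> \<noteq> 0" and "\<beta> \<noteq> 0" and "\<gamma> \<noteq> 0"
    and "\<alpha> * \<beta> ^ 2 = -1" and "\<beta> * \<gamma> = q"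
    and "\<forall>k::int. (\<alpha> * \<beta>) ^ 2 \<noteq> q powi (2 * k)"
    and "w \<noteq> 0"
    and "norm (\<gamma> / (\<alpha> ^ 2 * \<beta>)) < norm (\<gamma> * w / (\<alpha> * s))"
    and "norm (\<gamma> * w / (\<alpha> * s)) < 1"
  shows "1 / 2 * (qpoch_inf q (q ^ 2) / qpoch_inf (q ^ 2) (q ^ 2)) *
      (qpoch_inf (\<gamma> / \<alpha>) q / qpoch_inf (\<alpha> * \<beta>) q
         * psi11 (\<alpha> * \<beta>) (\<gamma> / \<alpha>) q (\<gamma> * w / (\<alpha> * s))
       + qpoch_inf (\<beta> ^ 2 * \<gamma>) q / qpoch_inf (1 / \<beta>) q
         * psi11 (1 / \<beta>) (\<beta> ^ 2 * \<gamma>) q (\<gamma> * w / (\<alpha> * s)))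
    = qpoch_inf (\<gamma> / (\<alpha> ^ 2 * \<beta>)) (q ^ 2) / qpoch_inf (\<alpha> ^ 2 * \<beta> ^ 2) (q ^ 2)
      * (qpoch_infs [\<alpha> * s / (\<gamma> * w) * q, \<alpha> * \<beta> * w / s * q] (q ^ 2)
         / qpoch_infs [\<gamma> * w / (\<alpha> * s), s / (\<alpha> * \<beta> * w)] (q ^ 2))"
proof -
  interpret q_base q using assms(1,2) by unfold_locales auto
  define a where "a = \<alpha> * \<beta>"
  define z where "z = \<gamma> * w / (\<alpha> * s)"
  have s: "s \<noteq> 0" using assms(1,3) by auto
  have a: "a \<noteq> 0" using assms(4,5) by (simp add: a_def)
  have "a * \<beta> = - 1" using assms(7) by (simp add: a_def power2_eq_square mult.assoc)
  then have \<beta>: "\<beta> = - 1 / a" using a by (simp add: field_simps)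
  have \<alpha>: "\<alpha> = - (a ^ 2)" using a assms(5) a_def unfolding \<beta> by (simp add: field_simps power2_eq_square)
  have \<gamma>: "\<gamma> = - (q * a)" using a assms(8) unfolding \<beta> by (simp add: field_simps) (metis minus_minus)
  \<comment> \<open>With \<open>q = s ^ 2\<close>, the division by \<open>s\<close> leaves a single
    factor \<open>s\<close>.\<close>
  have zs: "z = s * w / a" unfolding z_def \<alpha> \<gamma> assms(3)[symmetric] using a s
    by (simp add: field_simps power2_eq_square)
  have z: "z \<noteq> 0" "norm z < 1" using assms(10,12) a s by (auto simp: zs z_def[symmetric])
  have e: "\<gamma> / \<alpha> = q / a" "\<beta> ^ 2 * \<gamma> = - (q / a)" "1 / \<beta> = - a" "\<gamma> / (\<alpha> ^ 2 * \<beta>) = q / a ^ 2"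
    "\<alpha> ^ 2 * \<beta> ^ 2 = a ^ 2"
    unfolding \<alpha> \<beta> \<gamma> using a by (simp_all add: field_simps power2_eq_square)
  have "\<alpha> * s / (\<gamma> * w) = 1 / z" by (simp add: z_def)
  moreover have "\<alpha> * \<beta> * w / s * q = a ^ 2 * z"
    unfolding a_def[symmetric] zs assms(3)[symmetric] using a s by (simp add: field_simps power2_eq_square)
  moreover have "s / (\<alpha> * \<beta> * w) = q / (a ^ 2 * z)"
    unfolding a_def[symmetric] zs assms(3)[symmetric] using a s assms(10) by (simp add: field_simps power2_eq_square)
  \<comment> \<open>The lower bound of the annulus becomes \<open>norm (q / a ^ 2) < norm z\<close>
    in the new parameters.\<close>
  moreover have "norm (q / (a ^ 2 * z)) < 1"
  proof -
    have "norm (q / a ^ 2) < norm z" using assms(11) unfolding e(4) z_def .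
    then have "norm (q / a ^ 2) / norm z < 1" using z(1) by simp
    then show ?thesis by (simp add: norm_divide norm_mult)
  qed
  ultimately show ?thesis
    using psi11_pair[OF z(2,1) _ a] assms(9)
    unfolding e a_def[symmetric] z_def[symmetric] qpoch_infs_def by simp
qed

end
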